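(* Let $I=[l,u]$ with $l<u$, let $G:I\times\mathbb R^n\to\mathbb R$ and let $\rho$ be a probability density on $\mathbb R^n$ with $\mathbb E N(G,\rho,I)<+\infty$. Assume: (1) $G'(t,x)$ and $\nabla G(t,x)$ exist and are continuous on $I\times L(G(t,x),I)$; (2) the function $$T(\hat t)=\int_{L(G(t,x),\{\hat t\})}\rho(x)\frac{|G'(\hat t,x)|}{\|\nabla G(\hat t,x)\|}\,d\mathbb H^{n-1}$$ is Lebesgue integrable on $I$; (3) for every closed subinterval $\bar I=[a,b]\subseteq I$ with $a\ne b$, $\int_{\Xi(G(t,x),Q_2(t,x),\bar I)}\rho(x)\,dx=0$, where $Q_2(t,x)=G'(t,x)\|\nabla G(t,x)\|$. Then $\varphi_{G,\rho}$ is absolutely continuous on $[l,u]$, and $$\int_I\varphi_{G,\rho}'(t)\,dt=\varphi_{G,\rho}(u)-\varphi_{G,\rho}(l)=\mathbb E N(G,\rho,I).$$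
   Context: For $J\subseteq I$, $N(x,G,J)=\#\{t\in J\mid G(t,x)=0\}$ and $\mathbb E N(G,\rho,J)=\int_{\mathbb R^n}N(x,G,J)\rho(x)\,dx$. The cumulative expectation function is $\varphi_{G,\rho}(t)=\mathbb E N(G,\rho,[l,t])$, $t\in[l,u]$. Notation: $G'$ is the derivative in $t$; $\nabla G$ is the gradient in $x$; $\|\cdot\|$ is the Euclidean norm; $\mathbb H^m$ is $m$-dimensional Hausdorff measure. For $J\subseteq A\subseteq\mathbb R$ and functions $P(s,x),Q(s,x)$ on $A\times\mathbb R^n$: $L(P(s,x),J)=\bigcup_{s\in J}\{x\in\mathbb R^n\mid P(s,x)=0\}$; $\eta(P(s,x),J,x)=\{s\in J\mid P(s,x)=0\}$; $\Xi(P(s,x),Q(s,x),J)=\{x\in\mathbb R^n\mid\emptyset\ne\eta(P(s,x),J,x)\subseteq\eta(Q(s,x),J,x)\}$. *)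

theory Defs
  imports "HOL-Analysis.Analysis"
begin

subsection \<open>Hausdorff measure\<close>

text \<open>
  \<open>unit_ball_vol m * (diameter E / 2) ^ m\<close> is the usual normalisation, for which the
  \<open>m\<close>-dimensional measure agrees with Lebesgue measure on \<open>m\<close>-dimensional space.
  The empty set is singled out because \<open>0 ^ 0 = 1\<close>: for \<open>m = 0\<close> every nonempty set has
  size 1, so the 0-dimensional measure counts points. The library's
  \<open>diameter\<close> is meaningful only on bounded sets, hence the boundedness condition on covers.
\<close>

definition hausdorff_size :: "nat \<Rightarrow> 'a::metric_space set \<Rightarrow> ennreal" where
  "hausdorff_size m E =
     (if E = {} then 0 else ennreal (unit_ball_vol (real m) * (diameter E / 2) ^ m))"

definition hausdorff_covers :: "real \<Rightarrow> 'a::metric_space set \<Rightarrow> (nat \<Rightarrow> 'a set) set" where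
  "hausdorff_covers \<delta> A = {E. A \<subseteq> (\<Union>i. E i) \<and> (\<forall>i. bounded (E i) \<and> diameter (E i) \<le> \<delta>)}"

definition hausdorff_content :: "nat \<Rightarrow> real \<Rightarrow> 'a::metric_space set \<Rightarrow> ennreal" where
  "hausdorff_content m \<delta> A = (INF E\<in>hausdorff_covers \<delta> A. \<Sum>i. hausdorff_size m (E i))"

definition hausdorff_outer :: "nat \<Rightarrow> 'a::metric_space set \<Rightarrow> ennreal" where
  "hausdorff_outer m A = (SUP \<delta>\<in>{0<..}. hausdorff_content m \<delta> A)"

text \<open>The measure lives on the sets that are measurable in the sense of Caratheodory.\<close>

definition hausdorff_measure :: "nat \<Rightarrow> 'a::metric_space measure" where
  "hausdorff_measure m =
     measure_of UNIV (lambda_system UNIV UNIV (hausdorff_outer m)) (hausdorff_outer m)"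

lemma hausdorff_content_empty:
  assumes "0 < \<delta>"
  shows "hausdorff_content m \<delta> ({} :: 'a::metric_space set) = 0"
proof -
  have "(\<lambda>_. {}) \<in> hausdorff_covers \<delta> ({} :: 'a set)"
    using assms by (simp add: hausdorff_covers_def)
  then have "hausdorff_content m \<delta> ({} :: 'a set) \<le> (\<Sum>i. hausdorff_size m ({} :: 'a set))"
    unfolding hausdorff_content_def by (rule INF_lower2) simp
  then show ?thesis by (simp add: hausdorff_size_def)
qed

lemma hausdorff_content_mono:
  "A \<subseteq> B \<Longrightarrow> hausdorff_content m \<delta> A \<le> hausdorff_content m \<delta> B"
  unfolding hausdorff_content_def
  by (rule INF_superset_mono) (auto simp: hausdorff_covers_def)

lemma hausdorff_content_countably_subadditive:
  fixes A :: "nat \<Rightarrow> 'a::metric_space set"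
  shows "hausdorff_content m \<delta> (\<Union>i. A i) \<le> (\<Sum>i. hausdorff_content m \<delta> (A i))"
proof (rule ennreal_le_epsilon)
  fix e :: real
  assume e: "0 < e" and fin: "(\<Sum>i. hausdorff_content m \<delta> (A i)) < top"
  have "\<exists>E \<in> hausdorff_covers \<delta> (A n). (\<Sum>i. hausdorff_size m (E i))
          < hausdorff_content m \<delta> (A n) + e * (1/2) ^ Suc n" for n
  proof -
    have "hausdorff_content m \<delta> (A n) < hausdorff_content m \<delta> (A n) + e * (1/2) ^ Suc n"
      using e fin by (auto simp add: less_top dest!: ennreal_suminf_lessD)
    then show ?thesis
      unfolding hausdorff_content_def[of m \<delta> "A n"] INF_less_iff by auto
  qed
  then obtain B where B: "\<And>n. B n \<in> hausdorff_covers \<delta> (A n)"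
    and Ble: "\<And>n. (\<Sum>i. hausdorff_size m (B n i))
          \<le> hausdorff_content m \<delta> (A n) + e * (1/2) ^ Suc n"
    by (metis less_imp_le)
  define C where "C = case_prod B o prod_decode"
  have "C \<in> hausdorff_covers \<delta> (\<Union>i. A i)"
  proof -
    have "(\<Union>i. A i) \<subseteq> (\<Union>i. C i)"
    proof
      fix x assume "x \<in> (\<Union>i. A i)"
      then obtain n i where "x \<in> B n i"
        using B by (auto simp: hausdorff_covers_def) (meson UN_E subsetD)
      then have "x \<in> C (prod_encode (n, i))" by (simp add: C_def)
      then show "x \<in> (\<Union>i. C i)" by blast
    qed
    then show ?thesis
      using B by (auto simp: hausdorff_covers_def C_def split_def)
  qed
  then have "hausdorff_content m \<delta> (\<Union>i. A i) \<le> (\<Sum>i. hausdorff_size m (C i))"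
    unfolding hausdorff_content_def by (rule INF_lower)
  also have "\<dots> = (\<Sum>n. \<Sum>i. hausdorff_size m (B n i))"
    unfolding C_def comp_def by (intro suminf_ennreal_2dimen) auto
  also have "\<dots> \<le> (\<Sum>n. hausdorff_content m \<delta> (A n) + e * (1/2) ^ Suc n)"
    by (intro suminf_le allI Ble) auto
  also have "\<dots> = (\<Sum>n. hausdorff_content m \<delta> (A n)) + (\<Sum>n. ennreal e * ennreal ((1/2) ^ Suc n))"
    using e by (subst suminf_add[symmetric])
      (auto simp del: ennreal_suminf_cmult simp add: ennreal_mult[symmetric])
  also have "\<dots> = (\<Sum>n. hausdorff_content m \<delta> (A n)) + e"
    unfolding ennreal_suminf_cmult
    by (subst suminf_ennreal_eq[OF zero_le_power power_half_series]) auto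
  finally show "hausdorff_content m \<delta> (\<Union>i. A i) \<le> (\<Sum>i. hausdorff_content m \<delta> (A i)) + e" .
qed

lemma outer_measure_space_hausdorff_outer:
  "outer_measure_space UNIV (hausdorff_outer m :: 'a::metric_space set \<Rightarrow> ennreal)"
  unfolding outer_measure_space_def
proof (intro conjI)
  show "positive UNIV (hausdorff_outer m :: 'a set \<Rightarrow> ennreal)"
    by (auto simp: positive_def hausdorff_outer_def hausdorff_content_empty)
  show "increasing UNIV (hausdorff_outer m :: 'a set \<Rightarrow> ennreal)"
    unfolding increasing_def hausdorff_outer_def
    by (auto intro!: SUP_mono' hausdorff_content_mono)
  show "countably_subadditive UNIV (hausdorff_outer m :: 'a set \<Rightarrow> ennreal)"
    unfolding countably_subadditive_def
  proof (intro allI impI)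
    fix A :: "nat \<Rightarrow> 'a set"
    show "hausdorff_outer m (\<Union>i. A i) \<le> (\<Sum>i. hausdorff_outer m (A i))"
      unfolding hausdorff_outer_def[of m "\<Union>i. A i"]
    proof (rule SUP_least)
      fix \<delta> :: real assume d: "\<delta> \<in> {0<..}"
      have "hausdorff_content m \<delta> (\<Union>i. A i) \<le> (\<Sum>i. hausdorff_content m \<delta> (A i))"
        by (rule hausdorff_content_countably_subadditive)
      also have "\<dots> \<le> (\<Sum>i. hausdorff_outer m (A i))"
        unfolding hausdorff_outer_def using d by (intro suminf_le SUP_upper) auto
      finally show "hausdorff_content m \<delta> (\<Union>i. A i) \<le> (\<Sum>i. hausdorff_outer m (A i))" .
    qed
  qed
qed

lemma measure_space_hausdorff_outer:
  "measure_space UNIV (lambda_system UNIV UNIV (hausdorff_outer m))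
     (hausdorff_outer m :: 'a::metric_space set \<Rightarrow> ennreal)"
  using sigma_algebra.caratheodory_lemma[OF sigma_algebra_Pow,
      of UNIV "hausdorff_outer m :: 'a set \<Rightarrow> ennreal"]
    outer_measure_space_hausdorff_outer[of m, where 'a = 'a] by simp

lemma space_hausdorff_measure [simp]: "space (hausdorff_measure m) = UNIV"
  by (simp add: hausdorff_measure_def space_measure_of_conv)

lemma sets_hausdorff_measure:
  "sets (hausdorff_measure m :: 'a::metric_space measure) =
     lambda_system UNIV UNIV (hausdorff_outer m)"
  using measure_space_hausdorff_outer[of m, where 'a = 'a]
  by (simp add: hausdorff_measure_def measure_space_def sigma_algebra.sigma_sets_eq)

lemma emeasure_hausdorff_measure:
  fixes A :: "'a::metric_space set"
  assumes "A \<in> sets (hausdorff_measure m)"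
  shows "emeasure (hausdorff_measure m) A = hausdorff_outer m A"
  using measure_space_hausdorff_outer[of m, where 'a = 'a] assms unfolding sets_hausdorff_measure
  by (auto simp: hausdorff_measure_def measure_space_def intro!: emeasure_measure_of_sigma)

subsection \<open>Zero sets, numbers of zeros and their expectation\<close>

definition zeros :: "(real \<Rightarrow> 'a \<Rightarrow> real) \<Rightarrow> real set \<Rightarrow> 'a \<Rightarrow> real set"  (\<open>\<eta>\<close>) where
  "\<eta> P J x = {s \<in> J. P s x = 0}"

definition zero_locus :: "(real \<Rightarrow> 'a \<Rightarrow> real) \<Rightarrow> real set \<Rightarrow> 'a set"  (\<open>\<L>\<close>) where
  "\<L> P J = (\<Union>s\<in>J. {x. P s x = 0})"

definition common_zero_locus ::
  "(real \<Rightarrow> 'a \<Rightarrow> real) \<Rightarrow> (real \<Rightarrow> 'a \<Rightarrow> real) \<Rightarrow> real set \<Rightarrow> 'a set"  (\<open>\<Xi>\<close>) where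
  "\<Xi> P Q J = {x. \<eta> P J x \<noteq> {} \<and> \<eta> P J x \<subseteq> \<eta> Q J x}"

text \<open>Numbers of zeros and their expectations are extended nonnegative reals: there may be
  infinitely many zeros.\<close>

definition num_zeros :: "'a \<Rightarrow> (real \<Rightarrow> 'a \<Rightarrow> real) \<Rightarrow> real set \<Rightarrow> ennreal" where
  "num_zeros x G J = emeasure (count_space UNIV) {t \<in> J. G t x = 0}"

definition expected_zeros ::
  "(real \<Rightarrow> 'a::euclidean_space \<Rightarrow> real) \<Rightarrow> ('a \<Rightarrow> real) \<Rightarrow> real set \<Rightarrow> ennreal" where
  "expected_zeros G \<rho> J = (\<integral>\<^sup>+x. num_zeros x G J * ennreal (\<rho> x) \<partial>lebesgue)"

text \<open>The conversion to a real number loses nothing as long as the expectation over the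
  whole interval is finite.\<close>

definition cumulative_expectation ::
  "(real \<Rightarrow> 'a::euclidean_space \<Rightarrow> real) \<Rightarrow> ('a \<Rightarrow> real) \<Rightarrow> real \<Rightarrow> real \<Rightarrow> real" where
  "cumulative_expectation G \<rho> l t = enn2real (expected_zeros G \<rho> {l..t})"

subsection \<open>Surface integrals over the zero sets\<close>

text \<open>
  \<open>G'\<close> and \<open>gradG\<close> stand for the derivative of \<open>G\<close> in its first and the gradient in its
  second argument. Where \<open>gradG\<close> vanishes, the quotient is 0 by the convention for division
  by zero; any other nonnegative value could only enlarge the integral.
\<close>

definition level_integral ::
  "(real \<Rightarrow> real ^ 'n \<Rightarrow> real) \<Rightarrow> (real \<Rightarrow> real ^ 'n \<Rightarrow> real) \<Rightarrow>
   (real \<Rightarrow> real ^ 'n \<Rightarrow> real ^ 'n) \<Rightarrow> (real ^ 'n \<Rightarrow> real) \<Rightarrow> real \<Rightarrow> ennreal" where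
  "level_integral G G' gradG \<rho> t =
     (\<integral>\<^sup>+x\<in>\<L> G {t}. ennreal (\<rho> x * (\<bar>G' t x\<bar> / norm (gradG t x)))
        \<partial>hausdorff_measure (CARD('n) - 1))"

subsection \<open>Absolutely continuous functions\<close>

text \<open>The library's \<open>absolutely_continuous\<close> is a relation between measures.\<close>

definition absolutely_continuous_on :: "real set \<Rightarrow> (real \<Rightarrow> real) \<Rightarrow> bool" where
  "absolutely_continuous_on S f \<longleftrightarrow>
     (\<forall>\<epsilon>>0. \<exists>\<delta>>0. \<forall>(n::nat) a b.
        (\<forall>i<n. a i \<le> b i \<and> {a i..b i} \<subseteq> S) \<and>
        disjoint_family_on (\<lambda>i. {a i<..<b i}) {..<n} \<and>
        (\<Sum>i<n. b i - a i) < \<delta> \<longrightarrow>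
        (\<Sum>i<n. \<bar>f (b i) - f (a i)\<bar>) < \<epsilon>)"

end

theory Submission
  imports Defs
begin

text \<open>
  Let \<open>\<mu> S\<close> be the expected number of zeros whose parameter lies in \<open>S\<close>. This is a finite Borel
  measure on \<open>[l, u]\<close>, and the cumulative expectation is its distribution function. The proof shows
  that \<open>\<mu>\<close> is absolutely continuous with respect to Lebesgue measure. By the Radon--Nikodym theorem
  \<open>\<mu>\<close> then has an integrable density \<open>f\<close>, so the cumulative expectation is the indefinite integral
  of \<open>f\<close>; hence it is absolutely continuous, has derivative \<open>f\<close> almost everywhere by Lebesgue's
  differentiation theorem, and is recovered by integrating that derivative. It vanishes at \<open>l\<close>
  since \<open>\<mu> {l} = 0\<close>.

  Two facts give the absolute continuity of \<open>\<mu>\<close>. First, for almost every \<open>x\<close> charged by \<open>\<rho>\<close>, the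
  gradient is nonzero at every zero (\<open>AE_regular_zeros\<close>): the number of zeros is almost surely finite,
  so each zero is alone in some interval with rational ends, and a degenerate zero alone in an
  interval puts \<open>x\<close> into the corresponding set \<open>\<Xi>\<close>, which carries no mass. Second, for a null set
  \<open>N\<close> of parameters, the points having a zero with parameter in \<open>N\<close> and nonzero gradient form a
  null set (\<open>negligible_regular_zeros\<close>): near such a zero the parameter can replace one coordinate of
  \<open>x\<close> with Lipschitz inverse. This is the qualitative part of the coarea formula.

  For \<open>\<mu>\<close> to be a measure, the number of zeros in a Borel set must be measurable in \<open>x\<close>. Whether
  there is a zero in a compact interval is a closed condition relative to the zero locus, because
  \<open>G\<close> is jointly continuous there, and this determines the counts (\<open>measurable_count_Int_borel\<close>).
\<close>

section \<open>Null sets of parameters and regular zeros\<close>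

lemma continuous_on_real_locally_bounded:
  fixes h :: "'a::metric_space \<Rightarrow> real"
  assumes "continuous_on S h" "z \<in> S"
  obtains d where "0 < d" "\<And>w. w \<in> S \<Longrightarrow> dist w z < d \<Longrightarrow> \<bar>h w\<bar> \<le> \<bar>h z\<bar> + 1"
proof -
  obtain d where d: "d > 0" "\<And>w. w \<in> S \<Longrightarrow> dist w z < d \<Longrightarrow> dist (h w) (h z) < 1"
    using assms(1)[unfolded continuous_on_iff, rule_format, OF assms(2), of 1] by auto
  show ?thesis
  proof (rule that[OF d(1)])
    fix w assume "w \<in> S" "dist w z < d"
    then show "\<bar>h w\<bar> \<le> \<bar>h z\<bar> + 1"
      using d(2)[of w] by (simp add: dist_real_def)
  qed
qed

text \<open>
  Lebesgue measure on a Euclidean space is a product over the basis, and a product vanishes as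
  soon as one factor does.
\<close>

lemma negligible_coordinate_preimage:
  fixes N :: "real set" and b :: "'a::euclidean_space"
  assumes N: "negligible N" and b: "b \<in> Basis"
  shows "negligible {y::'a. y \<bullet> b \<in> N}"
proof -
  have "N \<in> null_sets lebesgue"
    using N by (simp add: negligible_iff_null_sets)
  then obtain N' where N': "N' \<in> null_sets lborel" and sub: "N \<subseteq> N'"
    by (meson null_sets_completionI null_sets_completion_iff2)
  have N'_sets [measurable]: "N' \<in> sets borel" and N'_null: "emeasure lborel N' = 0"
    using N' by auto
  interpret product_sigma_finite "\<lambda>_::'a. lborel :: real measure" ..
  have "emeasure (lborel :: 'a measure) {y. y \<bullet> b \<in> N'} =
    emeasure (\<Pi>\<^sub>M c\<in>Basis. lborel) {f \<in> space (\<Pi>\<^sub>M c\<in>(Basis::'a set). lborel). (\<Sum>c\<in>Basis. f c *\<^sub>R c) \<bullet> b \<in> N'}"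
    by (subst lborel_eq, subst emeasure_distr) (auto simp: vimage_def intro!: arg_cong2[where f=emeasure])
  also have "{f \<in> space (\<Pi>\<^sub>M c\<in>(Basis::'a set). lborel). (\<Sum>c\<in>Basis. f c *\<^sub>R c) \<bullet> b \<in> N'}
     = Pi\<^sub>E Basis (\<lambda>c. if c = b then N' else UNIV)"
    using b by (auto simp: space_PiM PiE_iff extensional_def split: if_splits)
  also have "emeasure (\<Pi>\<^sub>M c\<in>Basis. lborel) \<dots> = (\<Prod>c\<in>Basis. emeasure lborel (if c = b then N' else UNIV))"
    by (rule emeasure_PiM) auto
  also have "\<dots> = 0"
    using b N'_null by (intro prod_zero) auto
  finally have "{y::'a. y \<bullet> b \<in> N'} \<in> null_sets lborel"
    by (intro null_setsI) auto
  then have "negligible {y::'a. y \<bullet> b \<in> N'}"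
    by (simp add: negligible_iff_null_sets null_sets_completionI)
  then show ?thesis
    by (rule negligible_subset) (use sub in auto)
qed

text \<open>
  A quantitative implicit function theorem at two zeros only. Subtracting the equations
  \<open>G t x = 0\<close> and \<open>G t' x' = 0\<close> shows that \<open>g \<bullet> (x' - x)\<close> is of order \<open>t' - t\<close> up to the
  linearisation error; since \<open>g\<close> has a component of size at least \<open>1 / m\<close> along \<open>b\<close>, this
  controls the \<open>b\<close>-coordinate of \<open>x' - x\<close> by \<open>t' - t\<close> and the other coordinates. The right-hand
  side compares the points in which the \<open>b\<close>-coordinate has been replaced by the parameter.
\<close>

lemma implicit_Lipschitz_estimate:
  fixes G :: "real \<Rightarrow> 'a::euclidean_space \<Rightarrow> real" and g x x' b :: 'a and m t t' :: real
  assumes m: "0 < m" and b: "b \<in> Basis"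
    and zero: "G t x = 0" "G t' x' = 0"
    and g: "norm g \<le> m" "1 / m \<le> \<bar>g \<bullet> b\<bar>"
    and lin: "\<bar>G t x' - G t x - g \<bullet> (x' - x)\<bar> \<le> norm (x' - x) / (2 * m)"
    and lip: "\<bar>G t x' - G t' x'\<bar> \<le> m * \<bar>t' - t\<bar>"
  shows "norm (x' - x) \<le>
    (6 * m\<^sup>2 + 4) * norm ((x' + (t' - x' \<bullet> b) *\<^sub>R b) - (x + (t - x \<bullet> b) *\<^sub>R b))"
proof -
  define d where "d = (x' + (t' - x' \<bullet> b) *\<^sub>R b) - (x + (t - x \<bullet> b) *\<^sub>R b)"
  define e where "e = norm d"
  define s where "s = (x' - x) \<bullet> b"
  define k where "k = d - (t' - t) *\<^sub>R b"
  \<comment> \<open>\<open>k\<close> is the part of \<open>x' - x\<close> orthogonal to \<open>b\<close>.\<close>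
  have h: "x' - x = s *\<^sub>R b + k"
    by (simp add: d_def k_def s_def algebra_simps)
  have "d \<bullet> b = t' - t"
    using b by (simp add: d_def algebra_simps)
  then have t: "\<bar>t' - t\<bar> \<le> e"
    using Basis_le_norm[OF b, of d] by (simp add: e_def)
  have k: "norm k \<le> 2 * e"
    using norm_triangle_ineq4[of d "(t' - t) *\<^sub>R b"] t b by (simp add: k_def e_def)
  have hle: "norm (x' - x) \<le> \<bar>s\<bar> + 2 * e"
    unfolding h using norm_triangle_ineq[of "s *\<^sub>R b" k] k b by simp
  have gk: "\<bar>g \<bullet> k\<bar> \<le> m * (2 * e)"
    using Cauchy_Schwarz_ineq2[of g k] mult_mono[OF g(1) k] m by simp
  have "\<bar>g \<bullet> (x' - x)\<bar> \<le> m * e + norm (x' - x) / (2 * m)"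
  proof -
    have "\<bar>G t x'\<bar> \<le> m * e"
      using order_trans[OF lip mult_left_mono[OF t, of m]] zero m by simp
    then show ?thesis
      using lin zero by linarith
  qed
  also have "g \<bullet> (x' - x) = s * (g \<bullet> b) + g \<bullet> k"
    unfolding h by (simp add: inner_right_distrib)
  finally have "\<bar>s * (g \<bullet> b)\<bar> \<le> 3 * m * e + norm (x' - x) / (2 * m)"
    using gk by linarith
  moreover have "\<bar>s\<bar> / m \<le> \<bar>s * (g \<bullet> b)\<bar>"
    using mult_left_mono[OF g(2), of "\<bar>s\<bar>"] by (simp add: abs_mult)
  moreover have "norm (x' - x) / (2 * m) \<le> (\<bar>s\<bar> + 2 * e) / (2 * m)"
    using hle m by (intro divide_right_mono) auto
  ultimately have "\<bar>s\<bar> / m \<le> 3 * m * e + (\<bar>s\<bar> + 2 * e) / (2 * m)"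
    by linarith
  then have "\<bar>s\<bar> \<le> (6 * m\<^sup>2 + 2) * e"
    using m by (simp add: field_simps power2_eq_square)
  then show ?thesis
    using hle unfolding d_def[symmetric] by (simp add: e_def algebra_simps)
qed

text \<open>
  Near a zero \<open>(t, x)\<close> with \<open>gradG t x \<noteq> 0\<close>, one coordinate of
  \<open>x\<close> can be traded for the parameter \<open>t\<close>: by \<open>implicit_Lipschitz_estimate\<close> the map that replaces
  that coordinate by \<open>t\<close> is injective on a small piece of the zero set and has a Lipschitz
  inverse \<open>\<Phi>\<close>. It sends zeros with parameter in \<open>N\<close> into a set of points one of whose
  coordinates lies in \<open>N\<close>, which is null, and \<open>\<Phi>\<close> keeps null sets null.

  The set \<open>X\<close> need have no interior, and the mean value theorem cannot be used along segments in
  the space variable. The pieces \<open>P m r b\<close> therefore build a uniform rate of differentiability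
  into their definition: on each of them the remainder is bounded as in
  \<open>implicit_Lipschitz_estimate\<close>, with the same constant, up to the same distance \<open>r\<close>.
\<close>

lemma negligible_regular_zeros:
  fixes G G' :: "real \<Rightarrow> 'a::euclidean_space \<Rightarrow> real" and gradG :: "real \<Rightarrow> 'a \<Rightarrow> 'a"
  assumes I: "is_interval I" and N: "negligible N" "N \<subseteq> I"
    and deriv: "\<And>t x. t \<in> I \<Longrightarrow> x \<in> X \<Longrightarrow>
      ((\<lambda>s. G s x) has_real_derivative G' t x) (at t within I)"
    and deriv_cont: "continuous_on (I \<times> X) (\<lambda>(t, x). G' t x)"
    and grad: "\<And>t x. t \<in> I \<Longrightarrow> x \<in> X \<Longrightarrow> GDERIV (G t) x :> gradG t x"
  shows "negligible {x \<in> X. \<exists>t\<in>N. G t x = 0 \<and> gradG t x \<noteq> 0}"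
proof -
  define P where "P m r b = {(t, x). t \<in> N \<and> x \<in> X \<and> G t x = 0 \<and>
      norm (gradG t x) \<le> m \<and> 1 / m \<le> \<bar>gradG t x \<bullet> b\<bar> \<and>
      (\<forall>x'. norm (x' - x) < r \<longrightarrow>
        \<bar>G t x' - G t x - gradG t x \<bullet> (x' - x)\<bar> \<le> norm (x' - x) / (2 * m)) \<and>
      (\<forall>s\<in>I. \<forall>x'\<in>X. \<bar>s - t\<bar> < r \<and> norm (x' - x) < r \<longrightarrow> \<bar>G' s x'\<bar> \<le> m)}"
    for m :: real and r b
  obtain D :: "(real \<times> 'a) set" where D: "countable D"
    and dense: "\<And>S. open S \<Longrightarrow> S \<noteq> {} \<Longrightarrow> \<exists>d\<in>D. d \<in> S"
    using countable_dense_setE[where 'a="real \<times> 'a"] by blast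
  define bit where "bit m r b d = P m r b \<inter> ball d (r / 2)" for m r b d
  have bit_null: "negligible (snd ` bit m r b d)" if m: "0 < m" and r: "0 < r" and b: "b \<in> Basis" for m r b d
  proof -
    define \<Psi> where "\<Psi> = (\<lambda>(t, x). x + (t - x \<bullet> b) *\<^sub>R b)"
    have est: "norm (snd q - snd p) \<le> (6 * m\<^sup>2 + 4) * norm (\<Psi> q - \<Psi> p)"
      if pq: "p \<in> bit m r b d" "q \<in> bit m r b d" for p q
    proof -
      obtain t x t' x' where p: "p = (t, x)" and q: "q = (t', x')" by force
      have "dist p q < r"
        using pq dist_triangle_half_r[of d p r q] by (simp add: bit_def)
      then have close: "\<bar>t' - t\<bar> < r" "norm (x' - x) < r"
        using dist_fst_le[of q p] dist_snd_le[of q p] unfolding p q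
        by (auto simp: dist_commute dist_norm)
      have *: "(t, x) \<in> P m r b" "(t', x') \<in> P m r b"
        using pq by (auto simp: bit_def p q)
      define J where "J = I \<inter> ball t r"
      have "convex J"
        using I by (auto simp: J_def is_interval_convex_1 intro: convex_Int)
      \<comment> \<open>The mean value theorem applies in the parameter, which ranges over an interval.\<close>
      have "\<bar>G t x' - G t' x'\<bar> \<le> m * \<bar>t - t'\<bar>"
      proof (rule field_differentiable_bound[OF \<open>convex J\<close>, unfolded real_norm_def])
        fix s assume s: "s \<in> J"
        show "((\<lambda>s. G s x') has_real_derivative G' s x') (at s within J)"
          using s * by (intro DERIV_subset[OF deriv]) (auto simp: J_def P_def)
        show "\<bar>G' s x'\<bar> \<le> m"
          using s * close by (auto simp: J_def P_def dist_real_def abs_minus_commute)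
      qed (use * N close r in \<open>auto simp: J_def P_def dist_real_def abs_minus_commute\<close>)
      then have "norm (x' - x) \<le>
          (6 * m\<^sup>2 + 4) * norm ((x' + (t' - x' \<bullet> b) *\<^sub>R b) - (x + (t - x \<bullet> b) *\<^sub>R b))"
        using * close m b
        by (intro implicit_Lipschitz_estimate[where G=G and g="gradG t x"])
           (auto simp: P_def abs_minus_commute)
      then show ?thesis
        by (simp add: p q \<Psi>_def)
    qed
    define \<Phi> where "\<Phi> = snd \<circ> inv_into (bit m r b d) \<Psi>"
    have inv: "\<Phi> (\<Psi> p) = snd p" if "p \<in> bit m r b d" for p
    proof -
      let ?q = "inv_into (bit m r b d) \<Psi> (\<Psi> p)"
      have "?q \<in> bit m r b d" "\<Psi> ?q = \<Psi> p"
        using that by (auto intro!: inv_into_into f_inv_into_f)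
      then have "norm (snd p - snd ?q) \<le> (6 * m\<^sup>2 + 4) * norm (\<Psi> p - \<Psi> p)"
        using est[of ?q p] that by metis
      then have "snd ?q = snd p" by simp
      then show ?thesis by (simp add: \<Phi>_def)
    qed
    have "negligible (\<Psi> ` bit m r b d)"
    proof (rule negligible_subset[OF negligible_coordinate_preimage[OF N(1) b]])
      show "\<Psi> ` bit m r b d \<subseteq> {y. y \<bullet> b \<in> N}"
        using b by (auto simp: \<Psi>_def bit_def P_def algebra_simps)
    qed
    then have "negligible (\<Phi> ` \<Psi> ` bit m r b d)"
    proof (rule negligible_locally_Lipschitz_image[OF order_refl])
      fix y assume y: "y \<in> \<Psi> ` bit m r b d"
      show "\<exists>T B. open T \<and> y \<in> T \<and>
          (\<forall>z\<in>\<Psi> ` bit m r b d \<inter> T. norm (\<Phi> z - \<Phi> y) \<le> B * norm (z - y))"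
        using y est inv by (intro exI[of _ UNIV] exI[of _ "6 * m\<^sup>2 + 4"]) auto
    qed
    also have "\<Phi> ` \<Psi> ` bit m r b d = snd ` bit m r b d"
      using inv by (force simp: image_image)
    finally show ?thesis .
  qed
  have "\<exists>n k. \<exists>b\<in>Basis. (t, x) \<in> P (real (Suc n)) (1 / real (Suc k)) b"
    if that: "t \<in> N" "x \<in> X" "G t x = 0" "gradG t x \<noteq> 0" for t x
  proof -
    obtain b where b: "b \<in> Basis" "gradG t x \<bullet> b \<noteq> 0"
      using \<open>gradG t x \<noteq> 0\<close> by (meson euclidean_all_zero_iff)
    define M where "M = \<bar>G' t x\<bar> + 1"
    have t: "t \<in> I" using that N by auto
    obtain d1 where d1: "d1 > 0" and G'_bound: "\<And>w. w \<in> I \<times> X \<Longrightarrow> dist w (t, x) < d1 \<Longrightarrow>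
        \<bar>case w of (s, y) \<Rightarrow> G' s y\<bar> \<le> \<bar>case (t, x) of (s, y) \<Rightarrow> G' s y\<bar> + 1"
      by (rule continuous_on_real_locally_bounded[OF deriv_cont, of "(t, x)"]) (use t \<open>x \<in> X\<close> in auto)
    have G'_near: "\<bar>G' s x'\<bar> \<le> M" if "s \<in> I" "x' \<in> X" "dist (s, x') (t, x) < d1" for s x'
      using G'_bound[of "(s, x')"] that by (simp add: M_def)
    \<comment> \<open>The bound \<open>n\<close> comes first: it fixes the tolerance of the linearisation, which in turn
      decides how small the radius \<open>1 / Suc k\<close> has to be.\<close>
    obtain n where "norm (gradG t x) + 1 / \<bar>gradG t x \<bullet> b\<bar> + M \<le> real n"
      using real_arch_simple by blast
    then have "norm (gradG t x) + 1 / \<bar>gradG t x \<bullet> b\<bar> + M \<le> real (Suc n)"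
      by simp
    moreover have "0 \<le> 1 / \<bar>gradG t x \<bullet> b\<bar>" "0 \<le> M" "0 \<le> norm (gradG t x)"
      by (simp_all add: M_def)
    ultimately have n: "norm (gradG t x) \<le> real (Suc n)" "1 / \<bar>gradG t x \<bullet> b\<bar> \<le> real (Suc n)"
        "M \<le> real (Suc n)"
      by linarith+
    have "(G t has_derivative (\<lambda>h. h \<bullet> gradG t x)) (at x)"
      using grad[OF t \<open>x \<in> X\<close>] by (simp add: gderiv_def inner_commute)
    then obtain d2 where d2: "d2 > 0" and lin: "\<And>x'. norm (x' - x) < d2 \<Longrightarrow>
        norm (G t x' - G t x - (x' - x) \<bullet> gradG t x) \<le> 1 / (2 * real (Suc n)) * norm (x' - x)"
      using has_derivative_at_alt[THEN iffD1, THEN conjunct2, rule_format, of "G t" _ x "1 / (2 * real (Suc n))"]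
      by auto
    obtain k where k: "1 / real (Suc k) < min (d1 / 2) d2"
      using d1 d2 by (metis half_gt_zero min_less_iff_conj nat_approx_posE)
    have "(t, x) \<in> P (real (Suc n)) (1 / real (Suc k)) b"
      unfolding P_def
    proof (clarsimp simp only: mem_Collect_eq case_prod_conv, intro conjI allI impI ballI)
      show "1 / real (Suc n) \<le> \<bar>gradG t x \<bullet> b\<bar>"
        using n(2) b by (simp add: field_simps)
      show "\<bar>G t x' - G t x - gradG t x \<bullet> (x' - x)\<bar> \<le> norm (x' - x) / (2 * real (Suc n))"
        if "norm (x' - x) < 1 / real (Suc k)" for x'
        using lin[of x'] that k by (simp add: inner_commute)
      show "\<bar>G' s x'\<bar> \<le> real (Suc n)"
        if "s \<in> I" "x' \<in> X" "\<bar>s - t\<bar> < 1 / real (Suc k) \<and> norm (x' - x) < 1 / real (Suc k)"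
        for s x'
      proof (rule order_trans[OF G'_near n(3)])
        have "dist (s, x') (t, x) \<le> \<bar>s - t\<bar> + norm (x' - x)"
          using norm_Pair_le[of "s - t" "x' - x"] by (simp add: dist_norm)
        then show "dist (s, x') (t, x) < d1"
          using that(3) k by linarith
      qed (use that in auto)
    qed (use that n in auto)
    then show ?thesis
      using b by blast
  qed
  note P_cover = this
  have "{x \<in> X. \<exists>t\<in>N. G t x = 0 \<and> gradG t x \<noteq> 0} \<subseteq>
      (\<Union>n. \<Union>k. \<Union>b\<in>Basis. \<Union>d\<in>D. snd ` bit (real (Suc n)) (1 / real (Suc k)) b d)"
  proof clarify
    fix x t assume "x \<in> X" "t \<in> N" "G t x = 0" "gradG t x \<noteq> 0"
    then obtain n k b where b: "b \<in> Basis" and P: "(t, x) \<in> P (real (Suc n)) (1 / real (Suc k)) b"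
      using P_cover by blast
    obtain d where d: "d \<in> D" "d \<in> ball (t, x) (1 / real (Suc k) / 2)"
      using dense[of "ball (t, x) (1 / real (Suc k) / 2)"] by auto
    then have "(t, x) \<in> bit (real (Suc n)) (1 / real (Suc k)) b d"
      using P by (simp add: bit_def dist_commute)
    then show "x \<in> (\<Union>n. \<Union>k. \<Union>b\<in>Basis. \<Union>d\<in>D. snd ` bit (real (Suc n)) (1 / real (Suc k)) b d)"
      using b d by force
  qed
  moreover have "negligible (\<Union>n. \<Union>k. \<Union>b\<in>Basis. \<Union>d\<in>D. snd ` bit (real (Suc n)) (1 / real (Suc k)) b d)"
    using D
    by (simp only: negligible_iff_null_sets)
       (intro null_sets_UN' bit_null[unfolded negligible_iff_null_sets]
         countable_finite[OF finite_Basis] countableI_type; simp)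
  ultimately show ?thesis
    by (rule negligible_subset[rotated])
qed

section \<open>Measurability of the number of points in a random finite set\<close>

text \<open>
  Splitting off the largest point of \<open>Z\<close> in \<open>{a..b}\<close> by two rationals turns the condition on the
  cardinality into a countable combination of conditions on fewer points. The left end of the
  last interval is \<open>max a q\<close> because \<open>q\<close> may lie below \<open>a\<close> when \<open>m = 0\<close>.
\<close>

lemma Suc_le_card_Int_atLeastAtMost_iff:
  fixes Z :: "real set"
  assumes "finite Z"
  shows "Suc m \<le> card (Z \<inter> {a..b}) \<longleftrightarrow>
    (\<exists>p\<in>\<rat>. \<exists>q\<in>\<rat>. p < q \<and> m \<le> card (Z \<inter> {a..p}) \<and> Z \<inter> {max a q..b} \<noteq> {})"
proof
  assume *: "Suc m \<le> card (Z \<inter> {a..b})"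
  define z where "z = Max (Z \<inter> {a..b})"
  have fin: "finite (Z \<inter> {a..b})" using assms by simp
  have ne: "Z \<inter> {a..b} \<noteq> {}" using * by force
  have z: "z \<in> Z" "a \<le> z" "z \<le> b"
    using Max_in[OF fin ne] by (auto simp: z_def)
  define y where "y = Max (insert (z - 1) (Z \<inter> {a..b} - {z}))"
  have "y \<in> insert (z - 1) (Z \<inter> {a..b} - {z})"
    unfolding y_def using fin by (intro Max_in) auto
  then have "y < z"
    using Max_ge[OF fin, of y] unfolding z_def[symmetric] by force
  then obtain p where p: "p \<in> \<rat>" "y < p" "p < z"
    using Rats_dense_in_real by blast
  then obtain q where q: "q \<in> \<rat>" "p < q" "q < z"
    using Rats_dense_in_real by blast
  have "Z \<inter> {a..b} - {z} \<subseteq> Z \<inter> {a..p}"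
  proof
    fix w assume w: "w \<in> Z \<inter> {a..b} - {z}"
    then have "w \<le> y" unfolding y_def using fin by (intro Max_ge) auto
    then show "w \<in> Z \<inter> {a..p}" using w p by auto
  qed
  then have "card (Z \<inter> {a..b} - {z}) \<le> card (Z \<inter> {a..p})"
    using assms by (intro card_mono) auto
  moreover have "card (Z \<inter> {a..b} - {z}) = card (Z \<inter> {a..b}) - 1"
    using z by (intro card_Diff_singleton) auto
  ultimately have "m \<le> card (Z \<inter> {a..p})"
    using * by linarith
  moreover have "z \<in> Z \<inter> {max a q..b}"
    using z q by auto
  ultimately show "\<exists>p\<in>\<rat>. \<exists>q\<in>\<rat>. p < q \<and> m \<le> card (Z \<inter> {a..p}) \<and> Z \<inter> {max a q..b} \<noteq> {}"
    using p q by blast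
next
  assume "\<exists>p\<in>\<rat>. \<exists>q\<in>\<rat>. p < q \<and> m \<le> card (Z \<inter> {a..p}) \<and> Z \<inter> {max a q..b} \<noteq> {}"
  then obtain p q z where *: "p < q" "m \<le> card (Z \<inter> {a..p})" "z \<in> Z" "a \<le> z" "q \<le> z" "z \<le> b"
    by auto
  have "Suc m \<le> card (insert z (Z \<inter> {a..p}))"
    using * assms by simp
  also have "\<dots> \<le> card (Z \<inter> {a..b})"
    using * assms by (intro card_mono) auto
  finally show "Suc m \<le> card (Z \<inter> {a..b})" .
qed

lemma measurable_card_Int_atLeastAtMost:
  fixes Z :: "'a \<Rightarrow> real set"
  assumes fin: "\<And>x. x \<in> space M \<Longrightarrow> finite (Z x)"
    and hit: "\<And>a b. {x \<in> space M. Z x \<inter> {a..b} \<noteq> {}} \<in> sets M"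
  shows "(\<lambda>x. card (Z x \<inter> {a..b})) \<in> measurable M (count_space UNIV)"
proof -
  have ge: "{x \<in> space M. m \<le> card (Z x \<inter> {a..b})} \<in> sets M" for m a b
  proof (induction m arbitrary: a b)
    case 0
    then show ?case by simp
  next
    case (Suc m)
    have "{x \<in> space M. Suc m \<le> card (Z x \<inter> {a..b})} =
      (\<Union>p\<in>\<rat>. \<Union>q\<in>\<rat> \<inter> {p<..}. {x \<in> space M. m \<le> card (Z x \<inter> {a..p})} \<inter>
        {x \<in> space M. Z x \<inter> {max a q..b} \<noteq> {}})"
      (is "?A = ?B")
    proof (rule set_eqI)
      fix x show "x \<in> ?A \<longleftrightarrow> x \<in> ?B"
      proof (cases "x \<in> space M")
        case True
        then show ?thesis
          by (simp only: mem_Collect_eq UN_iff Int_iff greaterThan_iff Bex_def conj_assoc simp_thms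
              Suc_le_card_Int_atLeastAtMost_iff[OF fin[OF True], of m a b])
      qed simp
    qed
    also have "\<dots> \<in> sets M"
      by (rule sets.countable_UN''[OF countable_rat], rule sets.countable_UN''[OF countable_Int1[OF countable_rat]],
          rule sets.Int[OF Suc.IH hit])
    finally show ?case .
  qed
  show ?thesis
  proof (subst measurable_count_space_eq_countable; (intro conjI ballI)?)
    fix m :: nat
    have "(\<lambda>x. card (Z x \<inter> {a..b})) -` {m} \<inter> space M =
      {x \<in> space M. m \<le> card (Z x \<inter> {a..b})} - {x \<in> space M. Suc m \<le> card (Z x \<inter> {a..b})}"
      by auto
    then show "(\<lambda>x. card (Z x \<inter> {a..b})) -` {m} \<inter> space M \<in> sets M"
      by (simp only:) (rule sets.Diff[OF ge ge])
  qed auto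
qed

text \<open>
  Being able to tell measurably whether \<open>Z x\<close> meets a given closed interval is enough to count its
  points in every Borel set. The complement step of the induction subtracts, and this is where
  finiteness of \<open>Z x\<close> matters.
\<close>

lemma measurable_count_Int_borel:
  fixes Z :: "'a \<Rightarrow> real set"
  assumes fin: "\<And>x. x \<in> space M \<Longrightarrow> finite (Z x)"
    and hit: "\<And>a b. {x \<in> space M. Z x \<inter> {a..b} \<noteq> {}} \<in> sets M"
    and S: "S \<in> sets borel"
  shows "(\<lambda>x. emeasure (count_space UNIV) (Z x \<inter> S)) \<in> borel_measurable M"
proof -
  have closed_interval: "(\<lambda>x. emeasure (count_space UNIV) (Z x \<inter> {a..b})) \<in> borel_measurable M" for a b
  proof -
    have "(\<lambda>x. of_nat (card (Z x \<inter> {a..b})) :: ennreal) \<in> borel_measurable M"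
      using measurable_card_Int_atLeastAtMost[OF fin hit] by measurable
    then show ?thesis
      by (rule measurable_cong[THEN iffD1, rotated]) (simp add: fin)
  qed
  have "(\<lambda>x. SUP n. emeasure (count_space UNIV) (Z x \<inter> {- real n..real n})) \<in> borel_measurable M"
    by (intro borel_measurable_SUP closed_interval) auto
  moreover have "(SUP n. emeasure (count_space UNIV) (Z x \<inter> {- real n..real n})) =
      emeasure (count_space UNIV) (Z x)" for x
  proof -
    have "(\<Union>n. Z x \<inter> {- real n..real n}) = Z x"
    proof (intro subset_antisym subsetI)
      fix z assume "z \<in> Z x"
      moreover obtain n where "\<bar>z\<bar> \<le> real n" using real_arch_simple by blast
      ultimately show "z \<in> (\<Union>n. Z x \<inter> {- real n..real n})"
        by (auto simp: abs_le_iff intro!: exI[of _ n])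
    qed auto
    then show ?thesis
      by (subst SUP_emeasure_incseq) (auto simp: incseq_def)
  qed
  ultimately have total: "(\<lambda>x. emeasure (count_space UNIV) (Z x)) \<in> borel_measurable M"
    by simp
  show ?thesis
  using S
proof (induction S rule: borel_set_induct)
  case empty
  then show ?case by simp
next
  case (interval a b)
  show ?case by (rule closed_interval)
next
  case (compl S)
  have "emeasure (count_space UNIV) (Z x \<inter> - S) =
      emeasure (count_space UNIV) (Z x) - emeasure (count_space UNIV) (Z x \<inter> S)"
    if "x \<in> space M" for x
  proof -
    have "Z x \<inter> - S = Z x - Z x \<inter> S" by blast
    then show ?thesis
      using fin[OF that] by (simp only:) (intro emeasure_Diff; simp)
  qed
  moreover have "(\<lambda>x. emeasure (count_space UNIV) (Z x) - emeasure (count_space UNIV) (Z x \<inter> S))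
      \<in> borel_measurable M"
    using total compl(2) by (rule borel_measurable_minus_ennreal)
  ultimately show ?case
    by (subst measurable_cong)
next
  case (union F)
  have "(\<lambda>x. \<Sum>i. emeasure (count_space UNIV) (Z x \<inter> F i)) \<in> borel_measurable M"
    by (intro borel_measurable_suminf_order union)
  moreover have "(\<Sum>i. emeasure (count_space UNIV) (Z x \<inter> F i)) =
     emeasure (count_space UNIV) (Z x \<inter> \<Union>(range F))" for x
  proof -
    have "disjoint_family (\<lambda>i. Z x \<inter> F i)"
      using union(1) by (auto simp: disjoint_family_on_def)
    then have "(\<Sum>i. emeasure (count_space UNIV) (Z x \<inter> F i)) =
        emeasure (count_space UNIV) (\<Union>i. Z x \<inter> F i)"
      by (intro suminf_emeasure) auto
    then show ?thesis by (simp only: Int_UN_distrib)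
  qed
  ultimately show ?case
    by simp
qed
qed

section \<open>Indefinite Lebesgue integrals on the line\<close>

text \<open>
  Truncate \<open>\<bar>f\<bar>\<close> at a height \<open>n\<close> so large that the part above it has integral less than
  \<open>\<epsilon> / 2\<close>; what remains is bounded by \<open>n\<close>.
\<close>

lemma integral_uniformly_small:
  fixes f :: "'a \<Rightarrow> real"
  assumes f: "integrable M f" and e: "0 < \<epsilon>"
  obtains \<delta> :: real where "0 < \<delta>"
    "\<And>A. A \<in> sets M \<Longrightarrow> emeasure M A < ennreal \<delta> \<Longrightarrow> (\<integral>x. indicator A x * \<bar>f x\<bar> \<partial>M) < \<epsilon>"
proof -
  have meas [measurable]: "f \<in> borel_measurable M" using f by simp
  have "(\<lambda>n. \<integral>x. \<bar>f x\<bar> - min \<bar>f x\<bar> (real n) \<partial>M) \<longlonglongrightarrow> (\<integral>x. 0 \<partial>M)"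
  proof (rule integral_dominated_convergence[where w="\<lambda>x. \<bar>f x\<bar>"])
    have "(\<lambda>n. \<bar>f x\<bar> - min \<bar>f x\<bar> (real n)) \<longlonglongrightarrow> 0" for x
    proof (rule tendsto_eventually)
      show "\<forall>\<^sub>F n in sequentially. \<bar>f x\<bar> - min \<bar>f x\<bar> (real n) = 0"
        using eventually_ge_at_top[of "nat \<lceil>\<bar>f x\<bar>\<rceil>"] by eventually_elim (auto simp: nat_le_iff ceiling_le_iff)
    qed
    then show "AE x in M. (\<lambda>n. \<bar>f x\<bar> - min \<bar>f x\<bar> (real n)) \<longlonglongrightarrow> 0" by simp
  qed (use f in auto)
  then have "\<forall>\<^sub>F n in sequentially. (\<integral>x. \<bar>f x\<bar> - min \<bar>f x\<bar> (real n) \<partial>M) < \<epsilon> / 2"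
    using e by (intro order_tendstoD(2)) auto
  then obtain n where n: "(\<integral>x. \<bar>f x\<bar> - min \<bar>f x\<bar> (real n) \<partial>M) < \<epsilon> / 2"
    unfolding eventually_sequentially by blast
  define \<delta> where "\<delta> = \<epsilon> / (2 * (real n + 1))"
  show ?thesis
  proof
    show "0 < \<delta>" using e by (simp add: \<delta>_def)
    fix A assume A [measurable]: "A \<in> sets M" and small: "emeasure M A < ennreal \<delta>"
    have Afin: "emeasure M A < \<infinity>" using small by (simp add: less_top order_less_trans)
    have Ameas: "measure M A < \<delta>"
      using small Afin by (simp add: emeasure_eq_ennreal_measure ennreal_less_iff less_top)
    have int1: "integrable M (\<lambda>x. \<bar>f x\<bar> - min \<bar>f x\<bar> (real n))"
      by (rule Bochner_Integration.integrable_bound[OF f]) auto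
    have int2: "integrable M (\<lambda>x. real n * indicator A x)"
      using Afin by (intro integrable_mult_right) (simp add: integrable_indicator_iff)
    have "(\<integral>x. indicator A x * \<bar>f x\<bar> \<partial>M) \<le>
        (\<integral>x. (\<bar>f x\<bar> - min \<bar>f x\<bar> (real n)) + real n * indicator A x \<partial>M)"
      using f int1 int2 
      by (intro integral_mono integrable_mult_indicator[where 'b=real, simplified] Bochner_Integration.integrable_add)
         (auto simp: indicator_def)
    also have "\<dots> = (\<integral>x. \<bar>f x\<bar> - min \<bar>f x\<bar> (real n) \<partial>M) + real n * measure M A"
      using int1 int2 by simp
    also have "real n * measure M A \<le> real n * \<delta>"
      using Ameas by (intro mult_left_mono) auto
    also have "real n * \<delta> \<le> \<epsilon> / 2"
      using e by (simp add: \<delta>_def field_simps)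
    finally show "(\<integral>x. indicator A x * \<bar>f x\<bar> \<partial>M) < \<epsilon>"
      using n by simp
  qed
qed

text \<open>
  The integral of \<open>\<bar>f\<bar>\<close> over a set of small measure is small, whatever the number of intervals it
  consists of. Increments are taken over open intervals, since these are the ones that are disjoint in the
  definition of absolute continuity.
\<close>

lemma absolutely_continuous_on_indefinite_integral:
  fixes f :: "real \<Rightarrow> real"
  assumes f: "integrable lborel f"
    and F: "\<And>a b. l \<le> a \<Longrightarrow> a \<le> b \<Longrightarrow> b \<le> u \<Longrightarrow> F b - F a = (\<integral>x. indicator {a<..<b} x * f x \<partial>lborel)"
  shows "absolutely_continuous_on {l..u} F"
  unfolding absolutely_continuous_on_def
proof (intro allI impI)
  fix \<epsilon> :: real assume "0 < \<epsilon>"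
  from integral_uniformly_small[OF f this] obtain \<delta> where \<delta>: "0 < \<delta>"
    "\<And>A. A \<in> sets lborel \<Longrightarrow> emeasure lborel A < ennreal \<delta> \<Longrightarrow>
      (\<integral>x. indicator A x * \<bar>f x\<bar> \<partial>lborel) < \<epsilon>" by metis
  show "\<exists>\<delta>>0. \<forall>(n::nat) a b.
        (\<forall>i<n. a i \<le> b i \<and> {a i..b i} \<subseteq> {l..u}) \<and>
        disjoint_family_on (\<lambda>i. {a i<..<b i}) {..<n} \<and>
        (\<Sum>i<n. b i - a i) < \<delta> \<longrightarrow>
        (\<Sum>i<n. \<bar>F (b i) - F (a i)\<bar>) < \<epsilon>"
  proof (intro exI[of _ \<delta>] conjI \<delta>(1) allI impI, elim conjE)
    fix n :: nat and a b
    assume ab: "\<forall>i<n. a i \<le> b i \<and> {a i..b i} \<subseteq> {l..u}"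
      and disj: "disjoint_family_on (\<lambda>i. {a i<..<b i}) {..<n}"
      and len: "(\<Sum>i<n. b i - a i) < \<delta>"
    define A where "A = (\<Union>i<n. {a i<..<b i})"
    have A [measurable]: "A \<in> sets lborel" by (auto simp: A_def)
    have "emeasure lborel A = (\<Sum>i<n. emeasure lborel {a i<..<b i})"
      unfolding A_def using disj by (intro sum_emeasure[symmetric]) auto
    also have "\<dots> = ennreal (\<Sum>i<n. b i - a i)"
      using ab by (subst sum_ennreal[symmetric]) auto
    also have "\<dots> < ennreal \<delta>"
      using len \<delta>(1) ab by (intro ennreal_lessI)
    finally have small: "emeasure lborel A < ennreal \<delta>" .
    have int: "integrable lborel (\<lambda>x. indicator {a i<..<b i} x * \<bar>f x\<bar>)" for i
      using f by (intro integrable_mult_indicator[where 'b=real, simplified]) auto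
    have "(\<Sum>i<n. \<bar>F (b i) - F (a i)\<bar>) \<le> (\<Sum>i<n. \<integral>x. indicator {a i<..<b i} x * \<bar>f x\<bar> \<partial>lborel)"
    proof (rule sum_mono)
      fix i assume "i \<in> {..<n}"
      then have "l \<le> a i" "a i \<le> b i" "b i \<le> u" using ab by auto
      then have "\<bar>F (b i) - F (a i)\<bar> = \<bar>\<integral>x. indicator {a i<..<b i} x * f x \<partial>lborel\<bar>"
        using F by simp
      also have "\<dots> \<le> (\<integral>x. \<bar>indicator {a i<..<b i} x * f x\<bar> \<partial>lborel)"
        by (rule integral_abs_bound)
      finally show "\<bar>F (b i) - F (a i)\<bar> \<le> (\<integral>x. indicator {a i<..<b i} x * \<bar>f x\<bar> \<partial>lborel)"
        by (simp add: abs_mult)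
    qed
    also have "\<dots> = (\<integral>x. (\<Sum>i<n. indicator {a i<..<b i} x * \<bar>f x\<bar>) \<partial>lborel)"
      using int by (intro Bochner_Integration.integral_sum[symmetric])
    also have "\<dots> = (\<integral>x. indicator A x * \<bar>f x\<bar> \<partial>lborel)"
      by (simp only: A_def indicator_UN_disjoint[OF finite_lessThan disj] sum_distrib_right)
    also have "\<dots> < \<epsilon>"
      using \<delta>(2)[OF A small] .
    finally show "(\<Sum>i<n. \<bar>F (b i) - F (a i)\<bar>) < \<epsilon>" .
  qed
qed

text \<open>
  Lebesgue's differentiation theorem on the line. \<open>integrable_ccontinuous_explicit\<close> gives it for
  intervals whose left end is the base point; the left derivative is the right derivative of the
  reflected function \<open>\<lambda>x. f (- x)\<close>.
\<close>

lemma AE_has_real_derivative_indefinite_integral: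
  fixes f :: "real \<Rightarrow> real"
  assumes f: "\<And>a b. f integrable_on {a..b}"
    and F: "\<And>a b. l \<le> a \<Longrightarrow> a \<le> b \<Longrightarrow> b \<le> u \<Longrightarrow> F b - F a = integral {a..b} f"
  shows "AE t in lebesgue_on {l..u}. (F has_real_derivative f t) (at t)"
proof -
  obtain N1 where N1: "negligible N1" and right: "\<And>x e. \<lbrakk>x \<notin> N1; 0 < e\<rbrakk> \<Longrightarrow>
      \<exists>d>0. \<forall>h. 0 < h \<and> h < d \<longrightarrow> \<bar>integral {x..x + h} f / h - f x\<bar> < e"
    using integrable_ccontinuous_explicit[of f] f by (auto simp: divide_inverse_commute)
  have f': "(\<lambda>x. f (- x)) integrable_on {a..b}" for a b
    using f[of "- b" "- a"] Henstock_Kurzweil_Integration.integrable_reflect_real[where f=f and a="- b" and b="- a"] by simp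
  obtain N2 where N2: "negligible N2" and left0: "\<And>x e. \<lbrakk>x \<notin> N2; 0 < e\<rbrakk> \<Longrightarrow>
      \<exists>d>0. \<forall>h. 0 < h \<and> h < d \<longrightarrow> \<bar>integral {x..x + h} (\<lambda>x. f (- x)) / h - f (- x)\<bar> < e"
    using integrable_ccontinuous_explicit[of "\<lambda>x. f (- x)"] f' by (auto simp: divide_inverse_commute)
  have left: "\<exists>d>0. \<forall>h. 0 < h \<and> h < d \<longrightarrow> \<bar>integral {x - h..x} f / h - f x\<bar> < e"
    if "x \<notin> uminus ` N2" "0 < e" for x e
  proof -
    have "- x \<notin> N2" using that by force
    moreover have "integral {- x..- x + h} (\<lambda>x. f (- x)) = integral {x - h..x} f" for h
      using Henstock_Kurzweil_Integration.integral_reflect_real[where f=f and a="x - h" and b=x] by simp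
    ultimately show ?thesis
      using left0[of "- x" e] that by simp
  qed
  have N2': "negligible (uminus ` N2)"
    by (rule negligible_locally_Lipschitz_image[OF order_refl N2])
       (rule exI[of _ UNIV], rule exI[of _ 1], auto)
  define N where "N = N1 \<union> uminus ` N2 \<union> {l, u}"
  have "negligible N"
    using N1 N2' by (simp add: N_def)
  have D: "(F has_real_derivative f x) (at x)" if x: "l < x" "x < u" "x \<notin> N" for x
    unfolding DERIV_def LIM_def
  proof (intro allI impI)
    fix e :: real assume "0 < e"
    obtain d1 where d1: "d1 > 0" "\<And>h. 0 < h \<Longrightarrow> h < d1 \<Longrightarrow> \<bar>integral {x..x + h} f / h - f x\<bar> < e"
      using right[of x e] x \<open>0 < e\<close> by (auto simp: N_def)
    obtain d2 where d2: "d2 > 0" "\<And>h. 0 < h \<Longrightarrow> h < d2 \<Longrightarrow> \<bar>integral {x - h..x} f / h - f x\<bar> < e"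
      using left[of x e] x \<open>0 < e\<close> by (auto simp: N_def)
    define d where "d = Min {d1, d2, u - x, x - l}"
    have d: "d > 0" "d \<le> d1" "d \<le> d2" "d \<le> u - x" "d \<le> x - l"
      using d1 d2 x by (auto simp: d_def)
    show "\<exists>s>0. \<forall>h. h \<noteq> 0 \<and> dist h 0 < s \<longrightarrow> dist ((F (x + h) - F x) / h) (f x) < e"
    proof (intro exI[of _ d] conjI d(1) allI impI, elim conjE)
      fix h :: real assume h: "h \<noteq> 0" "dist h 0 < d"
      show "dist ((F (x + h) - F x) / h) (f x) < e"
      proof (cases "h > 0")
        case True
        then have "F (x + h) - F x = integral {x..x + h} f"
          using h d x by (intro F) auto
        then show ?thesis
          using d1(2)[of h] True h d by (simp add: dist_real_def)
      next
        case False
        then have "F x - F (x + h) = integral {x + h..x} f"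
          using h d x by (intro F) auto
        then have "(F (x + h) - F x) / h = integral {x + h..x} f / - h"
          using h by (simp add: field_simps)
        then show ?thesis
          using d2(2)[of "- h"] False h d by (simp add: dist_real_def)
      qed
    qed
  qed
  have "N \<in> null_sets lebesgue"
    using \<open>negligible N\<close> by (simp add: negligible_iff_null_sets)
  then have "AE t in lebesgue. t \<notin> N"
    by (rule AE_not_in)
  then have "AE t in lebesgue. t \<in> {l..u} \<longrightarrow> (F has_real_derivative f t) (at t)"
    by eventually_elim (auto intro!: D simp: N_def order.strict_iff_order)
  then show ?thesis
    by (simp add: AE_restrict_space_iff)
qed

lemma calculus_of_indefinite_integral:
  fixes f F :: "real \<Rightarrow> real"
  assumes "l \<le> u" and f: "integrable lborel f"
    and F: "\<And>a b. l \<le> a \<Longrightarrow> a \<le> b \<Longrightarrow> b \<le> u \<Longrightarrow> F b - F a = (\<integral>x. indicator {a..b} x * f x \<partial>lborel)"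
  shows "absolutely_continuous_on {l..u} F"
    and "AE t in lebesgue_on {l..u}. F differentiable (at t)"
    and "integrable (lebesgue_on {l..u}) (deriv F)"
    and "integral\<^sup>L (lebesgue_on {l..u}) (deriv F) = F u - F l"
proof -
  have [measurable]: "f \<in> borel_measurable borel" using f by simp
  show "absolutely_continuous_on {l..u} F"
  proof (rule absolutely_continuous_on_indefinite_integral[OF f])
    fix a b assume ab: "l \<le> a" "a \<le> b" "b \<le> u"
    have "AE x in lborel. x \<noteq> a \<and> x \<noteq> b"
      by (intro AE_conjI AE_lborel_singleton)
    then have "(\<integral>x. indicator {a..b} x * f x \<partial>lborel) = (\<integral>x. indicator {a<..<b} x * f x \<partial>lborel)"
      by (intro integral_cong_AE) (auto simp: indicator_def elim!: AE_mp)
    then show "F b - F a = (\<integral>x. indicator {a<..<b} x * f x \<partial>lborel)"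
      using F[OF ab] by simp
  qed
  have set_int: "set_integrable lborel {a..b} f" for a b
    unfolding set_integrable_def using f by (intro integrable_mult_indicator) auto
  have D: "AE t in lebesgue_on {l..u}. (F has_real_derivative f t) (at t)"
  proof (rule AE_has_real_derivative_indefinite_integral)
    show "f integrable_on {a..b}" for a b
      using set_borel_integral_eq_integral(1)[OF set_int] .
    show "F b - F a = integral {a..b} f" if "l \<le> a" "a \<le> b" "b \<le> u" for a b
      using set_borel_integral_eq_integral(2)[OF set_int, of a b] F[OF that]
      by (simp add: set_lebesgue_integral_def)
  qed
  then show "AE t in lebesgue_on {l..u}. F differentiable (at t)"
    by eventually_elim (auto simp: real_differentiable_def)
  have eq: "AE t in lebesgue_on {l..u}. f t = deriv F t"
    using D by eventually_elim (simp add: DERIV_imp_deriv)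
  have f_leb: "integrable lebesgue (\<lambda>x. indicator {l..u} x *\<^sub>R f x)"
    using set_int[of l u] unfolding set_integrable_def by (subst integrable_completion) auto
  then have f_on: "integrable (lebesgue_on {l..u}) f"
    by (simp add: integrable_restrict_space)
  have "AE t in lebesgue. t \<in> {l..u} \<longrightarrow> f t = deriv F t"
    using eq by (subst (asm) AE_restrict_space_iff) auto
  then have "AE t in lebesgue. indicator {l..u} t *\<^sub>R f t = indicator {l..u} t *\<^sub>R deriv F t"
    by eventually_elim (simp add: indicator_def)
  from borel_measurable_AE[OF borel_measurable_integrable[OF f_leb] this]
  have "(\<lambda>t. indicator {l..u} t *\<^sub>R deriv F t) \<in> borel_measurable lebesgue" .
  then have meas: "deriv F \<in> borel_measurable (lebesgue_on {l..u})"
    by (subst borel_measurable_restrict_space_iff) auto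
  show "integrable (lebesgue_on {l..u}) (deriv F)"
    using integrable_cong_AE[OF _ meas eq] f_on by auto
  have "integral\<^sup>L (lebesgue_on {l..u}) (deriv F) = integral\<^sup>L (lebesgue_on {l..u}) f"
    using integral_cong_AE[OF _ meas eq] f_on by auto
  also have "\<dots> = (\<integral>x. indicator {l..u} x * f x \<partial>lborel)"
    by (simp add: integral_restrict_space integral_completion)
  finally show "integral\<^sup>L (lebesgue_on {l..u}) (deriv F) = F u - F l"
    using F[of l u] assms by simp
qed

section \<open>The distribution of the zeros\<close>

text \<open>
  Separate continuity in \<open>x\<close> becomes joint continuity because \<open>G\<close> is Lipschitz in \<open>t\<close> with a
  locally uniform constant.
\<close>

lemma continuous_on_Times_if_has_derivative:
  fixes G G' :: "real \<Rightarrow> 'a::real_normed_vector \<Rightarrow> real"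
  assumes I: "is_interval I"
    and deriv: "\<And>t x. t \<in> I \<Longrightarrow> x \<in> X \<Longrightarrow>
      ((\<lambda>s. G s x) has_real_derivative G' t x) (at t within I)"
    and deriv_cont: "continuous_on (I \<times> X) (\<lambda>(t, x). G' t x)"
    and cont: "\<And>t. t \<in> I \<Longrightarrow> continuous_on X (G t)"
  shows "continuous_on (I \<times> X) (\<lambda>(t, x). G t x)"
proof (clarsimp simp: continuous_on_iff[of "I \<times> X"])
  fix t x and e :: real assume t: "t \<in> I" and x: "x \<in> X" and e: "0 < e"
  define M where "M = \<bar>G' t x\<bar> + 1"
  have M: "M > 0" by (simp add: M_def)
  obtain d1 where d1: "d1 > 0" and G'_bound: "\<And>w. w \<in> I \<times> X \<Longrightarrow> dist w (t, x) < d1 \<Longrightarrow>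
      \<bar>case w of (s, y) \<Rightarrow> G' s y\<bar> \<le> \<bar>case (t, x) of (s, y) \<Rightarrow> G' s y\<bar> + 1"
    by (rule continuous_on_real_locally_bounded[OF deriv_cont, of "(t, x)"]) (use t x in auto)
  have G'_near: "\<bar>G' s y\<bar> \<le> M" if "s \<in> I" "y \<in> X" "dist (s, y) (t, x) < d1" for s y
    using G'_bound[of "(s, y)"] that by (simp add: M_def)
  obtain d2 where d2: "d2 > 0" "\<And>y. y \<in> X \<Longrightarrow> dist y x < d2 \<Longrightarrow> dist (G t y) (G t x) < e / 2"
    using cont[OF t, unfolded continuous_on_iff, rule_format, OF x, of "e / 2"] e by auto
  define d where "d = Min {d1 / 2, d2, e / (2 * M)}"
  have d: "d > 0" "d \<le> d1 / 2" "d \<le> d2" "d \<le> e / (2 * M)"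
    using d1 d2 e M by (auto simp: d_def)
  show "\<exists>d>0. \<forall>s\<in>I. \<forall>y\<in>X. dist (s, y) (t, x) < d \<longrightarrow> dist (G s y) (G t x) < e"
  proof (intro exI[of _ d] conjI d(1) ballI impI)
    fix s y assume s: "s \<in> I" and y: "y \<in> X" and "dist (s, y) (t, x) < d"
    then have st: "\<bar>s - t\<bar> < d" and yx: "dist y x < d"
      using dist_fst_le[of "(s, y)" "(t, x)"] dist_snd_le[of "(s, y)" "(t, x)"]
      by (auto simp: dist_real_def)
    have conv: "convex (I \<inter> ball t d)"
      using I by (auto simp: is_interval_convex_1 intro: convex_Int)
    have "\<bar>G s y - G t y\<bar> \<le> M * \<bar>s - t\<bar>"
    proof (rule field_differentiable_bound[OF conv, unfolded real_norm_def])
      fix r assume r: "r \<in> I \<inter> ball t d"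
      show "((\<lambda>s. G s y) has_real_derivative G' r y) (at r within I \<inter> ball t d)"
        using r y by (intro DERIV_subset[OF deriv]) auto
      have "dist (r, y) (t, x) \<le> \<bar>r - t\<bar> + dist y x"
        using norm_Pair_le[of "r - t" "y - x"] by (simp add: dist_norm)
      then have "dist (r, y) (t, x) < d1"
        using r yx d by (auto simp: dist_real_def)
      then show "\<bar>G' r y\<bar> \<le> M"
        using r y by (intro G'_near) auto
    qed (use s t st d in \<open>auto simp: dist_real_def\<close>)
    also have "\<dots> \<le> M * (e / (2 * M))"
      using st d M by (intro mult_left_mono) auto
    also have "\<dots> = e / 2" using M by simp
    finally have "\<bar>G s y - G t y\<bar> \<le> e / 2" .
    moreover have "\<bar>G t y - G t x\<bar> < e / 2"
      using d2(2)[OF y] yx d by (simp add: dist_real_def)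
    ultimately show "dist (G s y) (G t x) < e"
      unfolding dist_real_def by linarith
  qed
qed

text \<open>
  The projection along a compact factor of a closed set is closed, here relative to \<open>X\<close>. The set
  \<open>X\<close> itself may fail to be measurable; only its measurable part \<open>W\<close> is looked at.
\<close>

lemma lebesgue_sets_compact_projection:
  fixes h :: "real \<times> 'a::euclidean_space \<Rightarrow> 'b::topological_space"
  assumes h: "continuous_on (C \<times> X) h" and "compact C" "closed F"
    and W: "W \<in> sets lebesgue" "W \<subseteq> X"
  shows "{x \<in> W. \<exists>t\<in>C. h (t, x) \<in> F} \<in> sets lebesgue"
proof -
  have "closedin (top_of_set (C \<times> X)) ((C \<times> X) \<inter> h -` F)"
    using h \<open>closed F\<close> by (rule continuous_closedin_preimage)
  from closedin_compact_projection[OF \<open>compact C\<close> this]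
  obtain T where T: "closed T" "{x. \<exists>t. t \<in> C \<and> (t, x) \<in> (C \<times> X) \<inter> h -` F} = X \<inter> T"
    by (auto simp: closedin_closed)
  have "{x \<in> W. \<exists>t\<in>C. h (t, x) \<in> F} = W \<inter> T"
    using T(2) W(2) by auto
  then show ?thesis
    using W T(1) by (auto intro: sets.Int)
qed

text \<open>
  The hypotheses under which the expected number of zeros in a set of parameters is an integral of
  a density over that set.
\<close>

locale random_zeros =
  fixes l u :: real
    and G G' :: "real \<Rightarrow> 'a::euclidean_space \<Rightarrow> real"
    and gradG :: "real \<Rightarrow> 'a \<Rightarrow> 'a"
    and \<rho> :: "'a \<Rightarrow> real"
  assumes l_less_u: "l < u"
    and density_measurable: "\<rho> \<in> borel_measurable lebesgue"
    and density_nonneg: "\<And>x. 0 \<le> \<rho> x"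
    and num_zeros_measurable:
      "(\<lambda>x. num_zeros x G {l..u} * ennreal (\<rho> x)) \<in> borel_measurable lebesgue"
    and expectation_finite: "expected_zeros G \<rho> {l..u} < \<infinity>"
    and deriv_exists: "\<And>t x. t \<in> {l..u} \<Longrightarrow> x \<in> \<L> G {l..u} \<Longrightarrow>
      ((\<lambda>s. G s x) has_real_derivative G' t x) (at t within {l..u})"
    and deriv_continuous: "continuous_on ({l..u} \<times> \<L> G {l..u}) (\<lambda>(t, x). G' t x)"
    and gradient_exists: "\<And>t x. t \<in> {l..u} \<Longrightarrow> x \<in> \<L> G {l..u} \<Longrightarrow>
      GDERIV (G t) x :> gradG t x"
    and gradient_continuous: "continuous_on ({l..u} \<times> \<L> G {l..u}) (\<lambda>(t, x). gradG t x)"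
    and degenerate_null: "\<And>a b. l \<le> a \<Longrightarrow> a < b \<Longrightarrow> b \<le> u \<Longrightarrow>
      (\<integral>\<^sup>+x\<in>\<Xi> G (\<lambda>t x. G' t x * norm (gradG t x)) {a..b}. ennreal (\<rho> x) \<partial>lebesgue) = 0"
begin

abbreviation Z :: "'a \<Rightarrow> real set" where "Z x \<equiv> \<eta> G {l..u} x"

text \<open>
  Up to a null set this is the set where the density charges a point with at least one zero. It is
  Lebesgue measurable although the zero locus may not be, since it is where the
  integrand of the expectation is neither \<open>0\<close> nor \<open>\<infinity>\<close>.
\<close>

definition fin_region :: "'a set" where
  "fin_region = {x. 0 < \<rho> x \<and> Z x \<noteq> {} \<and> finite (Z x)}"

lemma num_zeros_eq: "J \<subseteq> {l..u} \<Longrightarrow> num_zeros x G J = emeasure (count_space UNIV) (Z x \<inter> J)"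
  unfolding num_zeros_def zeros_def by (rule arg_cong[where f="emeasure (count_space UNIV)"]) auto

lemma Z_subset: "Z x \<subseteq> {l..u}"
  by (auto simp: zeros_def)

lemma num_zeros_total: "num_zeros x G {l..u} = emeasure (count_space UNIV) (Z x)"
  unfolding num_zeros_def zeros_def ..

lemma fin_region_subset: "fin_region \<subseteq> \<L> G {l..u}"
  by (auto simp: fin_region_def zeros_def zero_locus_def)

lemma sets_fin_region: "fin_region \<in> sets lebesgue"
proof -
  have "x \<in> fin_region \<longleftrightarrow> num_zeros x G {l..u} * ennreal (\<rho> x) \<noteq> 0 \<and>
      num_zeros x G {l..u} * ennreal (\<rho> x) < \<infinity>" for x
    using density_nonneg[of x]
    by (auto simp: fin_region_def num_zeros_total
        ennreal_mult_less_top emeasure_count_space ennreal_eq_0_iff of_nat_less_top)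
  then have "fin_region = {x \<in> space lebesgue. num_zeros x G {l..u} * ennreal (\<rho> x) \<noteq> 0 \<and>
      num_zeros x G {l..u} * ennreal (\<rho> x) < \<infinity>}"
    by auto
  also have "\<dots> \<in> sets lebesgue"
    using num_zeros_measurable by measurable
  finally show ?thesis .
qed

lemma AE_finite_zeros: "AE x in lebesgue. 0 < \<rho> x \<longrightarrow> Z x \<noteq> {} \<longrightarrow> x \<in> fin_region"
proof -
  have "AE x in lebesgue. num_zeros x G {l..u} * ennreal (\<rho> x) \<noteq> \<infinity>"
    using nn_integral_PInf_AE[OF num_zeros_measurable] expectation_finite
    by (simp add: expected_zeros_def)
  then show ?thesis
    by eventually_elim
      (auto simp: fin_region_def num_zeros_total
        ennreal_mult_eq_top_iff emeasure_count_space ennreal_eq_0_iff)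
qed

lemma G_continuous: "continuous_on ({l..u} \<times> \<L> G {l..u}) (\<lambda>(t, x). G t x)"
proof (rule continuous_on_Times_if_has_derivative[OF _ deriv_exists deriv_continuous])
  fix t assume "t \<in> {l..u}"
  then show "continuous_on (\<L> G {l..u}) (G t)"
    using gradient_exists unfolding gderiv_def
    by (intro continuous_at_imp_continuous_on ballI has_derivative_continuous)
qed (auto simp: is_interval_cc)

lemma sets_hit:
  assumes "l \<le> a" "b \<le> u"
  shows "{x \<in> fin_region. \<exists>t\<in>{a..b}. G t x = 0} \<in> sets lebesgue"
proof -
  have "continuous_on ({a..b} \<times> \<L> G {l..u}) (\<lambda>(t, x). G t x)"
    using G_continuous by (rule continuous_on_subset) (use assms in auto)
  from lebesgue_sets_compact_projection[OF this compact_Icc closed_singleton sets_fin_region fin_region_subset, of 0]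
  show ?thesis by simp
qed

text \<open>
  The integral over \<open>\<Xi>\<close> is a lower integral until the set is known to be measurable, so its
  vanishing says something about points only after measurability is shown. Intersected with
  \<open>fin_region\<close>, the set consists of the points with a zero in \<open>{a..b}\<close> minus those having
  a zero there at which the product is at least \<open>1 / (k + 1)\<close> in absolute value for some \<open>k\<close>;
  each of these sets is a compact projection.
\<close>

lemma AE_not_degenerate:
  assumes ab: "l \<le> a" "a < b" "b \<le> u"
  shows "AE x in lebesgue. x \<in> fin_region \<longrightarrow> x \<notin> \<Xi> G (\<lambda>t x. G' t x * norm (gradG t x)) {a..b}"
proof -
  let ?Q = "\<lambda>t x. G' t x * norm (gradG t x)"
  let ?X = "\<L> G {l..u}"
  define E where "E k = {x \<in> fin_region. \<exists>t\<in>{a..b}. (G t x, ?Q t x) \<in> {0} \<times> {q. 1 / real (Suc k) \<le> \<bar>q\<bar>}}" for k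
  have sub: "{a..b} \<times> ?X \<subseteq> {l..u} \<times> ?X" using ab by auto
  have cont: "continuous_on ({a..b} \<times> ?X) (\<lambda>(t, x). (G t x, ?Q t x))"
    using continuous_on_subset[OF G_continuous sub] continuous_on_subset[OF deriv_continuous sub]
      continuous_on_subset[OF gradient_continuous sub]
    unfolding split_def by (intro continuous_intros)
  have "E k \<in> sets lebesgue" for k
  proof -
    have "closed ({0::real} \<times> {q::real. 1 / real (Suc k) \<le> \<bar>q\<bar>})"
      by (intro closed_Times closed_singleton closed_Collect_le continuous_intros)
    from lebesgue_sets_compact_projection[OF cont compact_Icc this sets_fin_region fin_region_subset]
    show ?thesis by (simp add: E_def)
  qed
  moreover have "fin_region \<inter> \<Xi> G ?Q {a..b} = {x \<in> fin_region. \<exists>t\<in>{a..b}. G t x = 0} - (\<Union>k. E k)"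
  proof (intro set_eqI iffI)
    fix x assume x: "x \<in> {x \<in> fin_region. \<exists>t\<in>{a..b}. G t x = 0} - (\<Union>k. E k)"
    have "?Q t x = 0" if t: "t \<in> {a..b}" "G t x = 0" for t
    proof (rule ccontr)
      assume "?Q t x \<noteq> 0"
      then obtain k where "1 / real (Suc k) < \<bar>?Q t x\<bar>"
        using nat_approx_posE[of "\<bar>?Q t x\<bar>"] by auto
      then have "x \<in> E k" using x t by (auto simp: E_def intro!: bexI[of _ t])
      then show False using x by auto
    qed
    then show "x \<in> fin_region \<inter> \<Xi> G ?Q {a..b}"
      using x by (auto simp: common_zero_locus_def zeros_def)
  next
    fix x assume x: "x \<in> fin_region \<inter> \<Xi> G ?Q {a..b}"
    then have "?Q t x = 0" if "t \<in> {a..b}" "G t x = 0" for t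
      using that unfolding common_zero_locus_def zeros_def by blast
    then have "x \<notin> E k" for k
      unfolding E_def by fastforce
    then show "x \<in> {x \<in> fin_region. \<exists>t\<in>{a..b}. G t x = 0} - (\<Union>k. E k)"
      using x by (auto simp: common_zero_locus_def zeros_def)
  qed
  ultimately have meas: "fin_region \<inter> \<Xi> G ?Q {a..b} \<in> sets lebesgue"
    using sets_hit[of a b] ab by auto
  have "(\<integral>\<^sup>+x. ennreal (\<rho> x) * indicator (fin_region \<inter> \<Xi> G ?Q {a..b}) x \<partial>lebesgue) \<le>
      (\<integral>\<^sup>+x\<in>\<Xi> G ?Q {a..b}. ennreal (\<rho> x) \<partial>lebesgue)"
    by (intro nn_integral_mono) (auto simp: indicator_def)
  then have "(\<integral>\<^sup>+x. ennreal (\<rho> x) * indicator (fin_region \<inter> \<Xi> G ?Q {a..b}) x \<partial>lebesgue) = 0"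
    using degenerate_null[OF ab] by simp
  then have "AE x in lebesgue. ennreal (\<rho> x) * indicator (fin_region \<inter> \<Xi> G ?Q {a..b}) x = 0"
    using density_measurable meas by (subst (asm) nn_integral_0_iff_AE) auto
  then show ?thesis
    by eventually_elim (auto simp: fin_region_def indicator_def ennreal_eq_0_iff split: if_splits)
qed

text \<open>
  If \<open>t\<close> is one of finitely many zeros, some interval with rational ends contains no other zero,
  so a vanishing gradient at \<open>t\<close> puts \<open>x\<close> into one of countably many degenerate sets, all of them
  null.
\<close>

lemma AE_regular_zeros: "AE x in lebesgue. x \<in> fin_region \<longrightarrow> (\<forall>t\<in>Z x. gradG t x \<noteq> 0)"
proof -
  let ?Q = "\<lambda>t x. G' t x * norm (gradG t x)"
  have "AE x in lebesgue. \<forall>p\<in>\<rat>. \<forall>q\<in>\<rat>. max l p < min u q \<longrightarrow> x \<in> fin_region \<longrightarrow>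
      x \<notin> \<Xi> G ?Q {max l p..min u q}"
  proof (intro AE_ball_countable' countable_rat)
    fix p q :: real
    show "AE x in lebesgue. max l p < min u q \<longrightarrow> x \<in> fin_region \<longrightarrow> x \<notin> \<Xi> G ?Q {max l p..min u q}"
    proof (cases "max l p < min u q")
      case True
      then show ?thesis using AE_not_degenerate[of "max l p" "min u q"] by simp
    next
      case False
      then show ?thesis by (auto simp only:)
    qed
  qed
  then show ?thesis
  proof (eventually_elim, intro impI ballI notI)
    fix x t
    assume nondeg: "\<forall>p\<in>\<rat>. \<forall>q\<in>\<rat>. max l p < min u q \<longrightarrow> x \<in> fin_region \<longrightarrow>
        x \<notin> \<Xi> G ?Q {max l p..min u q}"
      and x: "x \<in> fin_region" and t: "t \<in> Z x" and grad0: "gradG t x = 0"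
    obtain d where d: "d > 0" "\<And>s. s \<in> Z x \<Longrightarrow> s \<noteq> t \<Longrightarrow> d \<le> dist t s"
      using x finite_set_avoid[of "Z x" t] by (auto simp: fin_region_def)
    obtain p where p: "p \<in> \<rat>" "t - d < p" "p < t"
      using Rats_dense_in_real[of "t - d" t] d by auto
    obtain q where q: "q \<in> \<rat>" "t < q" "q < t + d"
      using Rats_dense_in_real[of t "t + d"] d by auto
    have tI: "l \<le> t" "t \<le> u" "G t x = 0" using t by (auto simp: zeros_def)
    have only: "s = t" if "s \<in> {max l p..min u q}" "G s x = 0" for s
      using d(2)[of s] that p q by (force simp: zeros_def dist_real_def)
    have "x \<in> \<Xi> G ?Q {max l p..min u q}"
      using tI p q only grad0 by (auto simp: common_zero_locus_def zeros_def intro!: exI[of _ t])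
    moreover have "max l p < min u q"
      using tI p q l_less_u by auto
    ultimately show False
      using nondeg p q x by blast
  qed
qed

definition zero_count :: "real set \<Rightarrow> 'a \<Rightarrow> ennreal" where
  "zero_count S x = emeasure (count_space UNIV) (Z x \<inter> S) * indicator fin_region x * ennreal (\<rho> x)"

lemma zero_count_measurable:
  assumes S: "S \<in> sets borel"
  shows "zero_count S \<in> borel_measurable lebesgue"
proof -
  have "(\<lambda>x. emeasure (count_space UNIV) (Z x \<inter> S)) \<in> borel_measurable (restrict_space lebesgue fin_region)"
  proof (rule measurable_count_Int_borel[OF _ _ S])
    show "finite (Z x)" if "x \<in> space (restrict_space lebesgue fin_region)" for x
      using that by (simp add: space_restrict_space fin_region_def)
    show "{x \<in> space (restrict_space lebesgue fin_region). Z x \<inter> {a..b} \<noteq> {}}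
        \<in> sets (restrict_space lebesgue fin_region)" for a b
    proof -
      have "{x \<in> space (restrict_space lebesgue fin_region). Z x \<inter> {a..b} \<noteq> {}} =
          {x \<in> fin_region. \<exists>t\<in>{max l a..min u b}. G t x = 0}"
        by (auto simp: space_restrict_space zeros_def)
      then show ?thesis
        using sets_hit[of "max l a" "min u b"] sets_fin_region by (auto simp: sets_restrict_space_iff)
    qed
  qed
  then have "(\<lambda>x. emeasure (count_space UNIV) (Z x \<inter> S) * indicator fin_region x) \<in> borel_measurable lebesgue"
    using sets_fin_region by (subst (asm) borel_measurable_restrict_space_iff_ennreal) auto
  then show ?thesis
    unfolding zero_count_def using density_measurable by measurable
qed

lemma expected_zeros_eq:
  assumes "J \<subseteq> {l..u}"
  shows "expected_zeros G \<rho> J = (\<integral>\<^sup>+x. zero_count J x \<partial>lebesgue)"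
  unfolding expected_zeros_def
proof (rule nn_integral_cong_AE)
  show "AE x in lebesgue. num_zeros x G J * ennreal (\<rho> x) = zero_count J x"
    using AE_finite_zeros
  proof eventually_elim
    case (elim x)
    consider "x \<in> fin_region" | "\<rho> x = 0" | "Z x = {}"
      using elim density_nonneg[of x] by fastforce
    then show ?case
      by cases (auto simp: zero_count_def num_zeros_eq[OF assms])
  qed
qed

text \<open>
  The distribution of the zeros: the measure of \<open>S\<close> is the expected number of zeros in \<open>S\<close>.
  Absolute continuity of this measure is what makes the cumulative expectation absolutely
  continuous.
\<close>

definition zero_measure :: "real measure" where
  "zero_measure = measure_of UNIV (sets borel) (\<lambda>S. \<integral>\<^sup>+x. zero_count S x \<partial>lebesgue)"

lemma sets_zero_measure [simp]: "sets zero_measure = sets borel"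
  by (simp add: zero_measure_def sets_measure_of_conv sets.sigma_sets_eq[of borel, simplified])

lemma space_zero_measure [simp]: "space zero_measure = UNIV"
  by (simp add: zero_measure_def space_measure_of_conv)

lemma emeasure_zero_measure:
  assumes "S \<in> sets borel"
  shows "emeasure zero_measure S = (\<integral>\<^sup>+x. zero_count S x \<partial>lebesgue)"
proof (rule emeasure_measure_of[OF zero_measure_def])
  show "positive (sets zero_measure) (\<lambda>S. \<integral>\<^sup>+x. zero_count S x \<partial>lebesgue)"
    by (simp add: positive_def zero_count_def)
  show "countably_additive (sets zero_measure) (\<lambda>S. \<integral>\<^sup>+x. zero_count S x \<partial>lebesgue)"
  proof (rule countably_additiveI)
    fix A :: "nat \<Rightarrow> real set"
    assume A: "range A \<subseteq> sets zero_measure" and disj: "disjoint_family A"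
    have "(\<Sum>i. \<integral>\<^sup>+x. zero_count (A i) x \<partial>lebesgue) = (\<integral>\<^sup>+x. (\<Sum>i. zero_count (A i) x) \<partial>lebesgue)"
      using A by (intro nn_integral_suminf[symmetric] zero_count_measurable) auto
    also have "(\<lambda>x. \<Sum>i. zero_count (A i) x) = zero_count (\<Union>i. A i)"
    proof (rule ext)
      fix x
      have "disjoint_family (\<lambda>i. Z x \<inter> A i)"
        using disj by (auto simp: disjoint_family_on_def)
      then have "(\<Sum>i. emeasure (count_space UNIV) (Z x \<inter> A i)) =
          emeasure (count_space UNIV) (\<Union>i. Z x \<inter> A i)"
        by (intro suminf_emeasure) auto
      then show "(\<Sum>i. zero_count (A i) x) = zero_count (\<Union>i. A i) x"
        by (simp only: zero_count_def mult.assoc ennreal_suminf_multc Int_UN_distrib)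
    qed
    finally show "(\<Sum>i. \<integral>\<^sup>+x. zero_count (A i) x \<partial>lebesgue) =
        (\<integral>\<^sup>+x. zero_count (\<Union>i. A i) x \<partial>lebesgue)" .
  qed
qed (use assms in auto)

text \<open>
  Almost surely all zeros are regular, and regular zeros with parameter in a null set occur only
  for a null set of \<open>x\<close>.
\<close>

lemma absolutely_continuous_zero_measure: "absolutely_continuous lborel zero_measure"
  unfolding absolutely_continuous_def
proof
  fix N :: "real set" assume N: "N \<in> null_sets lborel"
  then have N_sets: "N \<in> sets borel" and "negligible (N \<inter> {l..u})"
    by (auto simp: negligible_iff_null_sets intro!: null_sets_completionI null_set_Int2)
  from negligible_regular_zeros[OF _ this(2) _ deriv_exists deriv_continuous gradient_exists]
  have "negligible {x \<in> \<L> G {l..u}. \<exists>t\<in>N \<inter> {l..u}. G t x = 0 \<and> gradG t x \<noteq> 0}"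
    by (simp add: is_interval_cc)
  then have "AE x in lebesgue. x \<notin> {x \<in> \<L> G {l..u}. \<exists>t\<in>N \<inter> {l..u}. G t x = 0 \<and> gradG t x \<noteq> 0}"
    by (intro AE_not_in) (simp add: negligible_iff_null_sets)
  then have "AE x in lebesgue. zero_count N x = 0"
    using AE_regular_zeros
  proof eventually_elim
    case (elim x)
    have "Z x \<inter> N = {}" if "x \<in> fin_region"
      using elim that fin_region_subset by (auto simp: zeros_def)
    then show ?case by (auto simp: zero_count_def indicator_def)
  qed
  then have "emeasure zero_measure N = 0"
    using emeasure_zero_measure[OF N_sets] zero_count_measurable[OF N_sets]
    by (simp add: nn_integral_0_iff_AE)
  then show "N \<in> null_sets zero_measure"
    using N_sets by auto
qed

lemma expected_zeros_has_density:
  obtains f :: "real \<Rightarrow> real" where "integrable lborel f"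
    "\<And>S. S \<in> sets borel \<Longrightarrow> S \<subseteq> {l..u} \<Longrightarrow>
      enn2real (expected_zeros G \<rho> S) = (\<integral>t. indicator S t * f t \<partial>lborel)"
proof -
  obtain g :: "real \<Rightarrow> ennreal" where g [measurable]: "g \<in> borel_measurable lborel"
    and dens: "density lborel g = zero_measure"
    using sigma_finite_measure.Radon_Nikodym[OF sigma_finite_lborel absolutely_continuous_zero_measure] by auto
  have g_int: "(\<integral>\<^sup>+t. g t * indicator S t \<partial>lborel) = (\<integral>\<^sup>+x. zero_count S x \<partial>lebesgue)"
    if "S \<in> sets borel" for S
    using emeasure_zero_measure[OF that] emeasure_density[of g lborel S] that dens by simp
  have "zero_count UNIV = zero_count {l..u}"
    by (intro ext) (simp add: zero_count_def Int_absorb2 Z_subset)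
  then have "(\<integral>\<^sup>+t. g t \<partial>lborel) < \<infinity>"
    using g_int[of UNIV] expectation_finite expected_zeros_eq[of "{l..u}"] by simp
  then have fin: "AE t in lborel. g t \<noteq> \<infinity>"
    by (intro nn_integral_PInf_AE) auto
  define f where "f t = enn2real (g t)" for t
  have [measurable]: "f \<in> borel_measurable borel"
    unfolding f_def using g by simp
  have fg: "AE t in lborel. ennreal (f t) = g t"
    using fin by eventually_elim (simp add: f_def less_top)
  have "(\<integral>\<^sup>+t. ennreal (f t) \<partial>lborel) = (\<integral>\<^sup>+t. g t \<partial>lborel)"
    using fg by (rule nn_integral_cong_AE)
  then have f: "integrable lborel f"
    using \<open>(\<integral>\<^sup>+t. g t \<partial>lborel) < \<infinity>\<close>
    by (intro integrableI_nonneg) (auto simp: f_def)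
  show ?thesis
  proof (rule that[OF f])
    fix S :: "real set" assume S: "S \<in> sets borel" "S \<subseteq> {l..u}"
    have "expected_zeros G \<rho> S = (\<integral>\<^sup>+t. g t * indicator S t \<partial>lborel)"
      using g_int[OF S(1)] expected_zeros_eq[OF S(2)] by simp
    also have "\<dots> = (\<integral>\<^sup>+t. ennreal (indicator S t * f t) \<partial>lborel)"
      using fg by (intro nn_integral_cong_AE, eventually_elim) (auto simp: indicator_def)
    finally show "enn2real (expected_zeros G \<rho> S) = (\<integral>t. indicator S t * f t \<partial>lborel)"
      using S by (subst integral_eq_nn_integral) (auto simp: f_def)
  qed
qed

end

section \<open>Absolute continuity of the cumulative expectation\<close>

theorem theorem1:
  fixes l u :: real
    and G G' :: "real \<Rightarrow> real ^ 'n \<Rightarrow> real"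
    and gradG :: "real \<Rightarrow> real ^ 'n \<Rightarrow> real ^ 'n"
    and \<rho> :: "real ^ 'n \<Rightarrow> real"
  assumes "l < u"
    and density_measurable: "\<rho> \<in> borel_measurable lebesgue"
    and density_nonneg: "\<And>x. 0 \<le> \<rho> x"
    and density_total: "(\<integral>\<^sup>+x. ennreal (\<rho> x) \<partial>lebesgue) = 1"
    and num_zeros_measurable:
      "(\<lambda>x. num_zeros x G {l..u} * ennreal (\<rho> x)) \<in> borel_measurable lebesgue"
    and expectation_finite: "expected_zeros G \<rho> {l..u} < \<infinity>"
    and deriv_exists: "\<And>t x. t \<in> {l..u} \<Longrightarrow> x \<in> \<L> G {l..u} \<Longrightarrow>
      ((\<lambda>s. G s x) has_real_derivative G' t x) (at t within {l..u})"
    and deriv_continuous: "continuous_on ({l..u} \<times> \<L> G {l..u}) (\<lambda>(t, x). G' t x)"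
    and gradient_exists: "\<And>t x. t \<in> {l..u} \<Longrightarrow> x \<in> \<L> G {l..u} \<Longrightarrow>
      GDERIV (G t) x :> gradG t x"
    and gradient_continuous: "continuous_on ({l..u} \<times> \<L> G {l..u}) (\<lambda>(t, x). gradG t x)"
    and level_integral_measurable:
      "level_integral G G' gradG \<rho> \<in> borel_measurable (lebesgue_on {l..u})"
    and level_integral_finite:
      "(\<integral>\<^sup>+t. level_integral G G' gradG \<rho> t \<partial>lebesgue_on {l..u}) < \<infinity>"
    and degenerate_null: "\<And>a b. l \<le> a \<Longrightarrow> a < b \<Longrightarrow> b \<le> u \<Longrightarrow>
      (\<integral>\<^sup>+x\<in>\<Xi> G (\<lambda>t x. G' t x * norm (gradG t x)) {a..b}. ennreal (\<rho> x) \<partial>lebesgue) = 0"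
  shows "absolutely_continuous_on {l..u} (cumulative_expectation G \<rho> l) \<and>
    (AE t in lebesgue_on {l..u}. cumulative_expectation G \<rho> l differentiable (at t)) \<and>
    integrable (lebesgue_on {l..u}) (deriv (cumulative_expectation G \<rho> l)) \<and>
    integral\<^sup>L (lebesgue_on {l..u}) (deriv (cumulative_expectation G \<rho> l)) =
      cumulative_expectation G \<rho> l u - cumulative_expectation G \<rho> l l \<and>
    cumulative_expectation G \<rho> l u - cumulative_expectation G \<rho> l l =
      enn2real (expected_zeros G \<rho> {l..u})"
proof -
  interpret random_zeros l u G G' gradG \<rho>
    by unfold_locales (fact assms(1) density_measurable density_nonneg num_zeros_measurable
        expectation_finite deriv_exists deriv_continuous gradient_exists gradient_continuous
        degenerate_null)+
  obtain f :: "real \<Rightarrow> real" where f: "integrable lborel f"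
    and density: "\<And>S. S \<in> sets borel \<Longrightarrow> S \<subseteq> {l..u} \<Longrightarrow>
      enn2real (expected_zeros G \<rho> S) = (\<integral>t. indicator S t * f t \<partial>lborel)"
    using expected_zeros_has_density by blast
  let ?\<phi> = "cumulative_expectation G \<rho> l"
  have \<phi>: "?\<phi> t = (\<integral>s. indicator {l..t} s * f s \<partial>lborel)" if "t \<le> u" for t
    unfolding cumulative_expectation_def using that by (intro density) auto
  have int: "integrable lborel (\<lambda>s. indicator {l..t} s * f s)" for t
    using f by (intro integrable_mult_indicator[where 'b=real, simplified]) auto
  have increment: "?\<phi> b - ?\<phi> a = (\<integral>s. indicator {a..b} s * f s \<partial>lborel)"
    if ab: "l \<le> a" "a \<le> b" "b \<le> u" for a b
  proof -
    have "?\<phi> b - ?\<phi> a = (\<integral>s. indicator {l..b} s * f s - indicator {l..a} s * f s \<partial>lborel)"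
      using ab int by (simp add: \<phi>)
    also have "\<dots> = (\<integral>s. indicator {a..b} s * f s \<partial>lborel)"
    proof (rule integral_cong_AE)
      show "AE s in lborel. indicator {l..b} s * f s - indicator {l..a} s * f s = indicator {a..b} s * f s"
        using AE_lborel_singleton[of a] by eventually_elim (use ab in \<open>auto simp: indicator_def\<close>)
    qed (use f in auto)
    finally show ?thesis .
  qed
  have "?\<phi> l = 0"
  proof -
    have "?\<phi> l = (\<integral>s. 0 \<partial>(lborel :: real measure))"
      unfolding \<phi>[OF less_imp_le[OF \<open>l < u\<close>]]
    proof (rule integral_cong_AE)
      show "AE s in lborel. indicator {l..l} s * f s = 0"
        using AE_lborel_singleton[of l] by eventually_elim auto
    qed (use f in auto)
    then show ?thesis by simp
  qed
  then have "?\<phi> u - ?\<phi> l = enn2real (expected_zeros G \<rho> {l..u})"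
    by (simp add: cumulative_expectation_def)
  then show ?thesis
    using calculus_of_indefinite_integral[OF less_imp_le[OF \<open>l < u\<close>] f increment] by blast
qed

end
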